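(* Let $R$ be a $2$-torsion free commutative ring with identity and let $(X,\leq)$ be a locally finite pre-ordered set. Then every generalized Jordan derivation of the incidence algebra $I(X,R)$ is a generalized derivation of $I(X,R)$.
   Context: A pre-ordered set $(X,\leq)$ is a set with a reflexive and transitive relation; it is locally finite if for all $x\leq y$ in $X$ there are only finitely many $z\in X$ with $x\leq z\leq y$. The incidence algebra is $$I(X,R)=\{f:X\times X\to R \mid f(x,y)=0 \text{ if } x\nleq y\},$$ with pointwise addition and scalar multiplication, and product $(fg)(x,y)=\sum_{x\leq z\leq y}f(x,z)g(z,y)$. A ring $R$ is $2$-torsion free if $2r=0$ implies $r=0$ for $r\in R$. For $x\leq y$, let $e_{xy}\in I(X,R)$ be the function with value $1$ at $(x,y)$ and $0$ elsewhere. Each $f\in I(X,R)$ is the (possibly infinite) sum $\sum_{x\leq y}f(x,y)e_{xy}$, where a family of elements of $I(X,R)$ is summable if for each pair $(u,v)$ only finitely many members of the family are nonzero at $(u,v)$, and its sum is then computed pointwise. Convention: a "linear map" $I(X,R)\to I(X,R)$ means a map preserving scalar multiplication and sums, including infinite sums of summable families (images of summable families are summable, and the map commutes with the sum). Let $A=I(X,R)$. Every derivation, Jordan derivation, generalized derivation and generalized Jordan derivation is a linear map $A\to A$, i.e. a map preserving scalar multiplication and sums, including infinite sums of summable families. - A derivation is a linear map $d$ with $d(ab)=d(a)b+a\,d(b)$ for all $a,b\in A$. - A Jordan derivation is a linear map $d$ with $d(a^2)=d(a)a+a\,d(a)$ for all $a\in A$. - A generalized derivation is a linear map $d$ for which there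 exists a derivation $\tau:A\to A$ such that $d(ab)=d(a)b+a\tau(b)$ for all $a,b\in A$. - A generalized Jordan derivation is a linear map $d$ for which there exists a Jordan derivation $\tau:A\to A$ such that $d(a^2)=d(a)a+a\tau(a)$ for all $a\in A$. *)

theory Defs
  imports Main
begin

text \<open>
  A pre-ordered set (X, \<le>) is a set X together with its order relation le, where
  \<^term>\<open>preorder_on X le\<close>. This includes le \<subseteq> X \<times> X, so X may be empty, and functions
  X \<times> X \<rightarrow> R supported on le are represented uniquely by (curried) functions
  on the whole type that vanish off le.
\<close>

definition locally_finite_rel :: "'x rel \<Rightarrow> bool" where
  "locally_finite_rel le \<longleftrightarrow>
     (\<forall>x y. (x, y) \<in> le \<longrightarrow> finite {z. (x, z) \<in> le \<and> (z, y) \<in> le})"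

definition inc_alg :: "'x rel \<Rightarrow> ('x \<Rightarrow> 'x \<Rightarrow> 'r::comm_ring) set" where
  "inc_alg le = {f. \<forall>x y. (x, y) \<notin> le \<longrightarrow> f x y = 0}"

definition inc_add ::
  "('x \<Rightarrow> 'x \<Rightarrow> 'r::comm_ring) \<Rightarrow> ('x \<Rightarrow> 'x \<Rightarrow> 'r) \<Rightarrow> 'x \<Rightarrow> 'x \<Rightarrow> 'r" where
  "inc_add f g = (\<lambda>x y. f x y + g x y)"

definition inc_scale :: "'r::comm_ring \<Rightarrow> ('x \<Rightarrow> 'x \<Rightarrow> 'r) \<Rightarrow> 'x \<Rightarrow> 'x \<Rightarrow> 'r" where
  "inc_scale c f = (\<lambda>x y. c * f x y)"

definition inc_mult ::
  "'x rel \<Rightarrow> ('x \<Rightarrow> 'x \<Rightarrow> 'r::comm_ring) \<Rightarrow> ('x \<Rightarrow> 'x \<Rightarrow> 'r) \<Rightarrow> 'x \<Rightarrow> 'x \<Rightarrow> 'r" where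
  "inc_mult le f g = (\<lambda>x y. \<Sum>z | (x, z) \<in> le \<and> (z, y) \<in> le. f x z * g z y)"

definition summable_family :: "'i set \<Rightarrow> ('i \<Rightarrow> 'x \<Rightarrow> 'x \<Rightarrow> 'r::comm_ring) \<Rightarrow> bool" where
  "summable_family I F \<longleftrightarrow> (\<forall>u v. finite {i\<in>I. F i u v \<noteq> 0})"

definition family_sum :: "'i set \<Rightarrow> ('i \<Rightarrow> 'x \<Rightarrow> 'x \<Rightarrow> 'r::comm_ring) \<Rightarrow> 'x \<Rightarrow> 'x \<Rightarrow> 'r" where
  "family_sum I F = (\<lambda>u v. \<Sum>i | i \<in> I \<and> F i u v \<noteq> 0. F i u v)"

text \<open>
  HOL cannot quantify over all index types inside a definition. Index sets are therefore
  taken inside 'x \<times> 'x \<times> nat. This is no restriction: the non-zero members of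
  any summable family can be indexed there. The lemma \<open>inc_linear_any_index\<close> below shows that
  summable families over an arbitrary index type are preserved.
\<close>

definition inc_linear ::
  "'x rel \<Rightarrow> (('x \<Rightarrow> 'x \<Rightarrow> 'r::comm_ring) \<Rightarrow> 'x \<Rightarrow> 'x \<Rightarrow> 'r) \<Rightarrow> bool" where
  "inc_linear le d \<longleftrightarrow>
     (\<forall>f\<in>inc_alg le. d f \<in> inc_alg le) \<and>
     (\<forall>c. \<forall>f\<in>inc_alg le. d (inc_scale c f) = inc_scale c (d f)) \<and>
     (\<forall>f\<in>inc_alg le. \<forall>g\<in>inc_alg le. d (inc_add f g) = inc_add (d f) (d g)) \<and>
     (\<forall>(I :: ('x \<times> 'x \<times> nat) set) F.
        (\<forall>i\<in>I. F i \<in> inc_alg le) \<longrightarrow> summable_family I F \<longrightarrow>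
        summable_family I (\<lambda>i. d (F i)) \<and>
        d (family_sum I F) = family_sum I (\<lambda>i. d (F i)))"

lemma inc_linear_any_index:
  fixes F :: "'i \<Rightarrow> 'x \<Rightarrow> 'x \<Rightarrow> 'r::comm_ring" and I :: "'i set"
  assumes d: "inc_linear le d"
    and F: "\<forall>i\<in>I. F i \<in> inc_alg le" and sF: "summable_family I F"
  shows "summable_family I (\<lambda>i. d (F i)) \<and> d (family_sum I F) = family_sum I (\<lambda>i. d (F i))"
proof -
  define J where "J = {i\<in>I. \<exists>u v. F i u v \<noteq> 0}"
  have "\<forall>i\<in>J. \<exists>p. F i (fst p) (snd p) \<noteq> 0" by (auto simp: J_def)
  then obtain p where p: "\<And>i. i \<in> J \<Longrightarrow> F i (fst (p i)) (snd (p i)) \<noteq> 0" by metis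
  have "finite {i\<in>J. p i = q}" for q
  proof -
    have "{i\<in>J. p i = q} \<subseteq> {i\<in>I. F i (fst q) (snd q) \<noteq> 0}" using p by (auto simp: J_def)
    then show ?thesis using sF by (auto simp: summable_family_def intro: finite_subset)
  qed
  then have "\<forall>q. \<exists>k. inj_on (k :: 'i \<Rightarrow> nat) {i\<in>J. p i = q}"
    using finite_imp_inj_to_nat_seg by blast
  then obtain k :: "'x \<times> 'x \<Rightarrow> 'i \<Rightarrow> nat" where k: "\<And>q. inj_on (k q) {i\<in>J. p i = q}" by metis
  define h where "h i = (fst (p i), snd (p i), k (p i) i)" for i
  have h: "inj_on h J"
  proof (rule inj_onI)
    fix i j assume ij: "i \<in> J" "j \<in> J" "h i = h j"
    then have pij: "p i = p j" by (simp add: h_def prod_eq_iff)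
    moreover from ij(3) have "k (p i) i = k (p j) j" by (simp add: h_def)
    ultimately have "k (p i) i = k (p i) j" by simp
    with k[of "p i"] ij pij show "i = j" by (auto simp: inj_on_def)
  qed
  define G where "G = (\<lambda>n. F (inv_into J h n))"
  have Gh: "G (h i) = F i" if "i \<in> J" for i using h that by (simp add: G_def)
  have d0: "d (F i) u v = 0" if "i \<in> I" "i \<notin> J" for i u v
  proof -
    have "F i = inc_scale 0 (F i)" using that by (auto simp: J_def inc_scale_def fun_eq_iff)
    moreover have "d (inc_scale 0 (F i)) = inc_scale 0 (d (F i))"
      using d F that by (auto simp: inc_linear_def)
    ultimately have "d (F i) = inc_scale 0 (d (F i))" by simp
    then show ?thesis by (metis inc_scale_def mult_zero_left)
  qed
  have setF: "{n\<in>h ` J. G n u v \<noteq> 0} = h ` {i\<in>I. F i u v \<noteq> 0}" for u v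
    using Gh by (force simp: J_def)
  have setd: "{n\<in>h ` J. d (G n) u v \<noteq> 0} = h ` {i\<in>I. d (F i) u v \<noteq> 0}" for u v
    using Gh d0 by (force simp: J_def)
  have subF: "{i\<in>I. F i u v \<noteq> 0} \<subseteq> J" for u v by (auto simp: J_def)
  have subd: "{i\<in>I. d (F i) u v \<noteq> 0} \<subseteq> J" for u v using d0 by auto
  have sG: "summable_family (h ` J) G"
    using sF by (simp add: summable_family_def setF)
  have "\<forall>n\<in>h ` J. G n \<in> inc_alg le" using Gh F by (auto simp: J_def)
  then have *: "summable_family (h ` J) (\<lambda>n. d (G n))"
      "d (family_sum (h ` J) G) = family_sum (h ` J) (\<lambda>n. d (G n))"
    using d sG unfolding inc_linear_def by blast+
  have sd: "summable_family I (\<lambda>i. d (F i))"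
    using *(1) finite_imageD[OF _ inj_on_subset[OF h subd]]
    by (simp add: summable_family_def setd)
  have GF: "G (h i) = F i" if "i \<in> I" "F i u v \<noteq> 0" for i u v
    using that by (intro Gh) (auto simp: J_def)
  have Gd: "G (h i) = F i" if "i \<in> I" "d (F i) u v \<noteq> 0" for i u v
    using that d0 by (intro Gh) auto
  have "family_sum (h ` J) G = family_sum I F"
    unfolding family_sum_def setF
    by (intro ext, subst sum.reindex[OF inj_on_subset[OF h subF]], rule sum.cong)
       (auto dest: GF)
  moreover have "family_sum (h ` J) (\<lambda>n. d (G n)) = family_sum I (\<lambda>i. d (F i))"
    unfolding family_sum_def setd
    by (intro ext, subst sum.reindex[OF inj_on_subset[OF h subd]], rule sum.cong)
       (auto dest: Gd)
  ultimately show ?thesis using *(2) sd by simp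
qed

definition derivation ::
  "'x rel \<Rightarrow> (('x \<Rightarrow> 'x \<Rightarrow> 'r::comm_ring) \<Rightarrow> 'x \<Rightarrow> 'x \<Rightarrow> 'r) \<Rightarrow> bool" where
  "derivation le d \<longleftrightarrow> inc_linear le d \<and>
     (\<forall>a\<in>inc_alg le. \<forall>b\<in>inc_alg le.
        d (inc_mult le a b) = inc_add (inc_mult le (d a) b) (inc_mult le a (d b)))"

definition jordan_derivation ::
  "'x rel \<Rightarrow> (('x \<Rightarrow> 'x \<Rightarrow> 'r::comm_ring) \<Rightarrow> 'x \<Rightarrow> 'x \<Rightarrow> 'r) \<Rightarrow> bool" where
  "jordan_derivation le d \<longleftrightarrow> inc_linear le d \<and>
     (\<forall>a\<in>inc_alg le.
        d (inc_mult le a a) = inc_add (inc_mult le (d a) a) (inc_mult le a (d a)))"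

definition generalized_derivation ::
  "'x rel \<Rightarrow> (('x \<Rightarrow> 'x \<Rightarrow> 'r::comm_ring) \<Rightarrow> 'x \<Rightarrow> 'x \<Rightarrow> 'r) \<Rightarrow> bool" where
  "generalized_derivation le d \<longleftrightarrow> inc_linear le d \<and>
     (\<exists>\<tau>. derivation le \<tau> \<and>
        (\<forall>a\<in>inc_alg le. \<forall>b\<in>inc_alg le.
           d (inc_mult le a b) = inc_add (inc_mult le (d a) b) (inc_mult le a (\<tau> b))))"

definition generalized_jordan_derivation ::
  "'x rel \<Rightarrow> (('x \<Rightarrow> 'x \<Rightarrow> 'r::comm_ring) \<Rightarrow> 'x \<Rightarrow> 'x \<Rightarrow> 'r) \<Rightarrow> bool" where
  "generalized_jordan_derivation le d \<longleftrightarrow> inc_linear le d \<and>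
     (\<exists>\<tau>. jordan_derivation le \<tau> \<and>
        (\<forall>a\<in>inc_alg le.
           d (inc_mult le a a) = inc_add (inc_mult le (d a) a) (inc_mult le a (\<tau> a))))"

text \<open>
  The definitions above do not use the identity of R. A commutative ring with identity is a type
  of sort {comm_ring, monoid_mult}, i.e. \<^class>\<open>comm_ring_1\<close> without the axiom 0 \<noteq> 1,
  so that the zero ring is included. Numerals need not exist there, hence r + r for 2r.
\<close>

definition two_torsion_free :: "'r::comm_ring itself \<Rightarrow> bool" where
  "two_torsion_free _ \<longleftrightarrow> (\<forall>r::'r. r + r = 0 \<longrightarrow> r = 0)"

end

theory Submission
  imports Defs "HOL-Library.Function_Algebras"
begin

text \<open>
  Let \<open>\<tau>\<close> be a Jordan derivation and write \<open>e\<^sub>x\<close> for \<open>e\<^sub>x\<^sub>x\<close>. The idempotent identities for the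
  \<open>e\<^sub>x\<close> show that \<open>\<tau>\<close> agrees on all of them with the inner derivation \<open>f \<mapsto> f g - g f\<close>, where
  \<open>g x y = \<tau>(e\<^sub>x) x y\<close>. The difference \<open>\<sigma>\<close> is a Jordan derivation that kills every \<open>e\<^sub>x\<close>, so it
  commutes with the Peirce projections: compressing \<open>f\<close> by \<open>e\<^sub>x\<close> and \<open>e\<^sub>y\<close>, and using
  \<open>e\<^sub>y\<^sub>x\<^sup>2 = 0\<close>, gives \<open>\<sigma>(f) x y = f x y * C x y\<close>. The Jordan identity for \<open>e\<^sub>x\<^sub>z\<close> and \<open>e\<^sub>z\<^sub>y\<close> makes
  \<open>C\<close> additive along chains, so \<open>\<sigma>\<close>, and with it \<open>\<tau>\<close>, is a derivation. Linearizing the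
  generalized Jordan identity at \<open>(a, 1)\<close> yields \<open>d(a) = d(1) a + \<tau>(a)\<close>, a generalized derivation.
\<close>

section \<open>Closure and bilinearity in the incidence algebra\<close>

lemma inc_add_eq_plus: "inc_add f g = f + g"
  by (simp add: inc_add_def fun_eq_iff)

lemma inc_alg_add: "f \<in> inc_alg le \<Longrightarrow> g \<in> inc_alg le \<Longrightarrow> f + g \<in> inc_alg le"
  by (auto simp: inc_alg_def)

lemma inc_alg_diff: "f \<in> inc_alg le \<Longrightarrow> g \<in> inc_alg le \<Longrightarrow> f - g \<in> inc_alg le"
  by (auto simp: inc_alg_def)

lemma inc_alg_scale: "f \<in> inc_alg le \<Longrightarrow> inc_scale c f \<in> inc_alg le"
  by (auto simp: inc_alg_def inc_scale_def)

lemma inc_scale_apply: "inc_scale c f u v = c * f u v"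
  by (simp add: inc_scale_def)

definition inc_unit :: "'x \<Rightarrow> 'x \<Rightarrow> 'x \<Rightarrow> 'x \<Rightarrow> 'r::{comm_ring, monoid_mult}" where
  "inc_unit x y = (\<lambda>u v. if u = x \<and> v = y then 1 else 0)"

text \<open>\<open>le\<close> is reflexive only on the carrier, which may be smaller than the type;
  cutting the Kronecker delta down to \<open>le\<close> keeps it in the algebra.\<close>

definition inc_one :: "'x rel \<Rightarrow> 'x \<Rightarrow> 'x \<Rightarrow> 'r::{comm_ring, monoid_mult}" where
  "inc_one le = (\<lambda>u v. if u = v \<and> (u, v) \<in> le then 1 else 0)"

lemma inc_unit_in_alg: "(x, y) \<in> le \<Longrightarrow> inc_unit x y \<in> inc_alg le"
  by (auto simp: inc_alg_def inc_unit_def)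

lemma inc_one_in_alg: "inc_one le \<in> inc_alg le"
  by (auto simp: inc_alg_def inc_one_def)

lemma inc_mult_add_left: "inc_mult le (f + g) h = inc_mult le f h + inc_mult le g h"
  by (simp add: inc_mult_def fun_eq_iff distrib_right sum.distrib)

lemma inc_mult_add_right: "inc_mult le h (f + g) = inc_mult le h f + inc_mult le h g"
  by (simp add: inc_mult_def fun_eq_iff distrib_left sum.distrib)

lemma inc_mult_diff_left: "inc_mult le (f - g) h = inc_mult le f h - inc_mult le g h"
  by (simp add: inc_mult_def fun_eq_iff left_diff_distrib sum_subtractf)

lemma inc_mult_diff_right: "inc_mult le h (f - g) = inc_mult le h f - inc_mult le h g"
  by (simp add: inc_mult_def fun_eq_iff right_diff_distrib sum_subtractf)

lemma inc_mult_scale_left: "inc_mult le (inc_scale c f) g = inc_scale c (inc_mult le f g)"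
  by (simp add: inc_mult_def inc_scale_def fun_eq_iff sum_distrib_left mult.assoc)

lemma inc_mult_scale_right: "inc_mult le f (inc_scale c g) = inc_scale c (inc_mult le f g)"
  by (simp add: inc_mult_def inc_scale_def fun_eq_iff sum_distrib_left mult.left_commute)

section \<open>Convolution over a locally finite pre-order: associativity, units, identity\<close>

locale lf_preorder =
  fixes X :: "'x set" and le :: "'x rel"
  assumes preorder: "preorder_on X le"
    and locally_finite: "locally_finite_rel le"
begin

abbreviation mult :: "('x \<Rightarrow> 'x \<Rightarrow> 'r::comm_ring) \<Rightarrow> ('x \<Rightarrow> 'x \<Rightarrow> 'r) \<Rightarrow> 'x \<Rightarrow> 'x \<Rightarrow> 'r"
    (infixl "\<star>" 70) where
  "f \<star> g \<equiv> inc_mult le f g"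

lemma le_trans: "(x, y) \<in> le \<Longrightarrow> (y, z) \<in> le \<Longrightarrow> (x, z) \<in> le"
  using preorder by (auto simp: preorder_on_def trans_def)

lemma le_refl:
  assumes "(x, y) \<in> le"
  shows "(x, x) \<in> le" "(y, y) \<in> le"
  using preorder assms by (auto simp: preorder_on_def refl_on_def)

text \<open>Transitivity empties the interval when \<open>(x, y) \<notin> le\<close>. Hence no
  convolution sum takes the default value 0 of an infinite sum.\<close>

lemma finite_interval: "finite {z. (x, z) \<in> le \<and> (z, y) \<in> le}"
proof (cases "(x, y) \<in> le")
  case True
  then show ?thesis using locally_finite by (auto simp: locally_finite_rel_def)
next
  case False
  then have "{z. (x, z) \<in> le \<and> (z, y) \<in> le} = {}" using le_trans by blast
  then show ?thesis by (simp only: finite.emptyI)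
qed

lemma mult_in_alg: "f \<star> g \<in> inc_alg le"
proof -
  have "(f \<star> g) x y = 0" if "(x, y) \<notin> le" for x y
  proof -
    have "{z. (x, z) \<in> le \<and> (z, y) \<in> le} = {}" using that le_trans by blast
    then show ?thesis by (simp only: inc_mult_def sum.empty)
  qed
  then show ?thesis by (simp add: inc_alg_def)
qed

lemma mult_assoc: "f \<star> g \<star> h = f \<star> (g \<star> h)"
proof (intro ext)
  fix x y
  let ?I = "\<lambda>x y. {z. (x, z) \<in> le \<and> (z, y) \<in> le}"
  have "(f \<star> g \<star> h) x y = (\<Sum>z\<in>?I x y. \<Sum>w\<in>?I x z. f x w * g w z * h z y)"
    by (simp add: inc_mult_def sum_distrib_right)
  \<comment> \<open>Both iterated sums run over chains x \<le> w \<le> z \<le> y; a restricted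
    common interval makes the sums exchangeable.\<close>
  also have "\<dots> = (\<Sum>z\<in>?I x y. \<Sum>w\<in>{w \<in> ?I x y. (w, z) \<in> le}. f x w * g w z * h z y)"
    by (intro sum.cong refl) (use le_trans in blast)+
  also have "\<dots> = (\<Sum>w\<in>?I x y. \<Sum>z\<in>{z \<in> ?I x y. (w, z) \<in> le}. f x w * g w z * h z y)"
    by (rule sum.swap_restrict) (rule finite_interval)+
  also have "\<dots> = (\<Sum>w\<in>?I x y. \<Sum>z\<in>?I w y. f x w * g w z * h z y)"
    by (intro sum.cong refl) (use le_trans in blast)+
  also have "\<dots> = (f \<star> (g \<star> h)) x y"
    by (simp add: inc_mult_def sum_distrib_left mult.assoc)
  finally show "(f \<star> g \<star> h) x y = (f \<star> (g \<star> h)) x y" .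
qed

lemma unit_mult:
  assumes "(x, y) \<in> le" "f \<in> inc_alg le"
  shows "(inc_unit x y \<star> f) u v = (if u = x then f y v else 0)"
proof -
  have "(inc_unit x y \<star> f) u v =
      (\<Sum>z | (u, z) \<in> le \<and> (z, v) \<in> le. if z = y then (if u = x then f y v else 0) else 0)"
    unfolding inc_mult_def inc_unit_def by (intro sum.cong) auto
  also have "\<dots> = (if u = x then f y v else 0)"
    using assms finite_interval by (auto simp: inc_alg_def)
  finally show ?thesis .
qed

lemma mult_unit:
  assumes "(x, y) \<in> le" "f \<in> inc_alg le"
  shows "(f \<star> inc_unit x y) u v = (if v = y then f u x else 0)"
proof -
  have "(f \<star> inc_unit x y) u v =
      (\<Sum>z | (u, z) \<in> le \<and> (z, v) \<in> le. if z = x then (if v = y then f u x else 0) else 0)"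
    unfolding inc_mult_def inc_unit_def by (intro sum.cong) auto
  also have "\<dots> = (if v = y then f u x else 0)"
    using assms finite_interval by (auto simp: inc_alg_def)
  finally show ?thesis .
qed

lemma one_mult:
  assumes "f \<in> inc_alg le"
  shows "inc_one le \<star> f = f"
proof (intro ext)
  fix u v
  have "(inc_one le \<star> f) u v =
      (\<Sum>z | (u, z) \<in> le \<and> (z, v) \<in> le. if z = u then f u v else 0)"
    unfolding inc_mult_def inc_one_def by (intro sum.cong) auto
  also have "\<dots> = f u v"
    using assms finite_interval le_refl by (cases "(u, v) \<in> le") (auto simp: inc_alg_def)
  finally show "(inc_one le \<star> f) u v = f u v" .
qed

lemma mult_one:
  assumes "f \<in> inc_alg le"
  shows "f \<star> inc_one le = f"
proof (intro ext)
  fix u v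
  have "(f \<star> inc_one le) u v =
      (\<Sum>z | (u, z) \<in> le \<and> (z, v) \<in> le. if z = v then f u v else 0)"
    unfolding inc_mult_def inc_one_def by (intro sum.cong) auto
  also have "\<dots> = f u v"
    using assms finite_interval le_refl by (cases "(u, v) \<in> le") (auto simp: inc_alg_def)
  finally show "(f \<star> inc_one le) u v = f u v" .
qed

end

section \<open>Jordan derivations and their values on diagonal units\<close>

locale finitary_jordan = lf_preorder X le
  for X :: "'x set" and le :: "'x rel" +
  fixes \<tau> :: "('x \<Rightarrow> 'x \<Rightarrow> 'r::{comm_ring, monoid_mult}) \<Rightarrow> 'x \<Rightarrow> 'x \<Rightarrow> 'r"
  assumes closed: "f \<in> inc_alg le \<Longrightarrow> \<tau> f \<in> inc_alg le"
    and scale: "f \<in> inc_alg le \<Longrightarrow> \<tau> (inc_scale c f) = inc_scale c (\<tau> f)"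
    and add: "f \<in> inc_alg le \<Longrightarrow> g \<in> inc_alg le \<Longrightarrow> \<tau> (f + g) = \<tau> f + \<tau> g"
    and square: "f \<in> inc_alg le \<Longrightarrow> \<tau> (f \<star> f) = \<tau> f \<star> f + f \<star> \<tau> f"
begin

lemma zero: "\<tau> 0 = 0"
  using add[of 0 0] by (simp add: inc_alg_def)

lemma jordan:
  assumes "f \<in> inc_alg le" "g \<in> inc_alg le"
  shows "\<tau> (f \<star> g + g \<star> f) = \<tau> f \<star> g + f \<star> \<tau> g + \<tau> g \<star> f + g \<star> \<tau> f"
proof -
  have "(f + g) \<star> (f + g) = f \<star> f + g \<star> g + (f \<star> g + g \<star> f)"
    by (simp add: inc_mult_add_left inc_mult_add_right)
  then have "\<tau> ((f + g) \<star> (f + g)) = \<tau> (f \<star> f) + \<tau> (g \<star> g) + \<tau> (f \<star> g + g \<star> f)"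
    by (simp add: add mult_in_alg inc_alg_add)
  moreover have "\<tau> ((f + g) \<star> (f + g)) = (\<tau> f + \<tau> g) \<star> (f + g) + (f + g) \<star> (\<tau> f + \<tau> g)"
    by (simp add: square add inc_alg_add assms)
  ultimately show ?thesis
    by (simp add: square assms inc_mult_add_left inc_mult_add_right algebra_simps)
qed

text \<open>The unit is idempotent, so its image is supported on row and column \<open>x\<close>. At
  \<open>(x, x)\<close> the equation reads t = t + t, which forces t = 0.\<close>

lemma unit_diag:
  assumes "(x, x) \<in> le"
  shows "\<tau> (inc_unit x x) u v =
    (if v = x then \<tau> (inc_unit x x) u x else 0) + (if u = x then \<tau> (inc_unit x x) x v else 0)"
proof -
  let ?e = "inc_unit x x :: 'x \<Rightarrow> 'x \<Rightarrow> 'r"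
  have e: "?e \<in> inc_alg le" using assms by (rule inc_unit_in_alg)
  have "?e \<star> ?e = ?e"
    by (simp add: fun_eq_iff unit_mult assms e) (simp add: inc_unit_def)
  with square[OF e] have "\<tau> ?e u v = (\<tau> ?e \<star> ?e + ?e \<star> \<tau> ?e) u v" by simp
  then show ?thesis by (simp add: unit_mult mult_unit assms closed e)
qed

text \<open>Orthogonal idempotents have anticommutator 0; the \<open>(x, y)\<close> entry of the
  linearized identity is the sum of the two values.\<close>

lemma unit_diag_orthogonal:
  assumes "(x, y) \<in> le" "x \<noteq> y"
  shows "\<tau> (inc_unit y y) x y = - \<tau> (inc_unit x x) x y"
proof -
  let ?e = "inc_unit x x :: 'x \<Rightarrow> 'x \<Rightarrow> 'r" and ?f = "inc_unit y y :: 'x \<Rightarrow> 'x \<Rightarrow> 'r"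
  have xx: "(x, x) \<in> le" and yy: "(y, y) \<in> le" using le_refl assms by blast+
  have e: "?e \<in> inc_alg le" and f: "?f \<in> inc_alg le"
    using xx yy by (simp_all add: inc_unit_in_alg)
  have "?e \<star> ?f + ?f \<star> ?e = 0"
    using assms by (simp add: fun_eq_iff unit_mult xx yy e f) (auto simp: inc_unit_def)
  with jordan[OF e f] zero
  have "(\<tau> ?e \<star> ?f + ?e \<star> \<tau> ?f + \<tau> ?f \<star> ?e + ?f \<star> \<tau> ?e) x y = 0" by simp
  then show ?thesis
    using assms by (simp add: unit_mult mult_unit xx yy closed e f eq_neg_iff_add_eq_0 add.commute)
qed

end

section \<open>Jordan derivations that kill the diagonal units\<close>

locale diagonal_jordan = finitary_jordan X le \<tau>
  for X :: "'x set" and le :: "'x rel"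
    and \<tau> :: "('x \<Rightarrow> 'x \<Rightarrow> 'r::{comm_ring, monoid_mult}) \<Rightarrow> 'x \<Rightarrow> 'x \<Rightarrow> 'r" +
  assumes vanish: "(x, x) \<in> le \<Longrightarrow> \<tau> (inc_unit x x) = 0"
    and torsion_free: "two_torsion_free TYPE('r)"
begin

text \<open>Anticommuting with a killed idempotent commutes with \<open>\<tau>\<close>; this plays
  the role of a Peirce projection.\<close>

lemma jordan_diag:
  assumes "(x, x) \<in> le" "f \<in> inc_alg le"
  shows "\<tau> (inc_unit x x \<star> f + f \<star> inc_unit x x) u v =
    (if u = x then \<tau> f x v else 0) + (if v = x then \<tau> f u x else 0)"
proof -
  have "g \<star> 0 = 0" "0 \<star> g = 0" for g :: "'x \<Rightarrow> 'x \<Rightarrow> 'r"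
    by (simp_all add: inc_mult_def fun_eq_iff)
  with jordan[OF inc_unit_in_alg[OF assms(1)] assms(2)] show ?thesis
    by (simp add: vanish assms unit_mult mult_unit closed)
qed

text \<open>For h = ef + fe, eh + he = h + 2 f(x,x) e. As \<open>\<tau>\<close> kills e, the entry t
  of \<open>\<tau> h\<close> at \<open>(x, x)\<close> satisfies t = 2t. But t is twice the entry of
  \<open>\<tau> f\<close>, so 2-torsion freeness applies.\<close>

lemma diag_eq_0:
  assumes f: "f \<in> inc_alg le"
  shows "\<tau> f x x = 0"
proof (cases "(x, x) \<in> le")
  case xx: True
  let ?e = "inc_unit x x :: 'x \<Rightarrow> 'x \<Rightarrow> 'r"
  define h where "h = ?e \<star> f + f \<star> ?e"
  have h: "h \<in> inc_alg le" by (simp add: h_def inc_alg_add mult_in_alg)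
  have e: "?e \<in> inc_alg le" using xx by (rule inc_unit_in_alg)
  have h_app: "h u v = (if u = x then f x v else 0) + (if v = x then f u x else 0)" for u v
    by (simp add: h_def unit_mult mult_unit xx f)
  have "?e \<star> h + h \<star> ?e = h + inc_scale (f x x + f x x) ?e"
    by (simp add: fun_eq_iff unit_mult mult_unit xx h)
       (auto simp: h_app inc_scale_apply inc_unit_def)
  then have "\<tau> (?e \<star> h + h \<star> ?e) x x = \<tau> h x x"
    by (simp add: add scale h e inc_alg_scale vanish xx inc_scale_apply)
  then have "\<tau> h x x = 0" using jordan_diag[OF xx h, of x x] by simp
  moreover have "\<tau> h x x = \<tau> f x x + \<tau> f x x"
    using jordan_diag[OF xx f, of x x] by (simp add: h_def)
  ultimately show ?thesis using torsion_free unfolding two_torsion_free_def by metis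
next
  case False
  then show ?thesis using closed[OF f] by (simp add: inc_alg_def)
qed

lemma unit_transpose:
  assumes "(y, x) \<in> le" "x \<noteq> y"
  shows "\<tau> (inc_unit y x) x y = 0"
proof -
  let ?e = "inc_unit y x :: 'x \<Rightarrow> 'x \<Rightarrow> 'r"
  have e: "?e \<in> inc_alg le" using assms by (simp add: inc_unit_in_alg)
  have "?e \<star> ?e = 0"
    using assms by (simp add: fun_eq_iff unit_mult e) (auto simp: inc_unit_def)
  with square[OF e] zero have "(\<tau> ?e \<star> ?e + ?e \<star> \<tau> ?e) x x = 0" by simp
  then show ?thesis using assms by (simp add: unit_mult mult_unit e closed)
qed

text \<open>Thus \<open>\<tau>\<close> is a Schur multiplier. Anticommuting with the units at
  \<open>x\<close> and then \<open>y\<close> preserves the entry of the image and leaves of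
  \<open>f\<close> only its entries at \<open>(x, y)\<close> and \<open>(y, x)\<close>; the second
  contributes nothing by \<open>unit_transpose\<close>.\<close>

lemma pointwise:
  assumes f: "f \<in> inc_alg le" and xy: "(x, y) \<in> le"
  shows "\<tau> f x y = f x y * \<tau> (inc_unit x y) x y"
proof (cases "x = y")
  case True
  then show ?thesis using diag_eq_0 f xy by (simp add: vanish)
next
  case False
  let ?e = "inc_unit x x :: 'x \<Rightarrow> 'x \<Rightarrow> 'r" and ?e' = "inc_unit y y :: 'x \<Rightarrow> 'x \<Rightarrow> 'r"
  have xx: "(x, x) \<in> le" and yy: "(y, y) \<in> le" using le_refl xy by blast+
  define h where "h = ?e \<star> f + f \<star> ?e"
  have h: "h \<in> inc_alg le" by (simp add: h_def inc_alg_add mult_in_alg)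
  have h_app: "h u v = (if u = x then f x v else 0) + (if v = x then f u x else 0)" for u v
    by (simp add: h_def unit_mult mult_unit xx f)
  let ?a = "inc_scale (f x y) (inc_unit x y)" and ?b = "inc_scale (f y x) (inc_unit y x)"
  have a: "?a \<in> inc_alg le" using xy by (intro inc_alg_scale inc_unit_in_alg)
  \<comment> \<open>If \<open>(y, x) \<notin> le\<close>, the unit lies outside the algebra, but its
    coefficient \<open>f y x\<close> is 0.\<close>
  have b: "?b \<in> inc_alg le \<and> \<tau> ?b x y = 0"
  proof (cases "(y, x) \<in> le")
    case True
    then show ?thesis
      using False by (simp add: inc_alg_scale inc_unit_in_alg scale inc_scale_apply unit_transpose)
  next
    case yx: False
    then have "?b = 0" using f by (simp add: inc_alg_def inc_scale_apply fun_eq_iff)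
    then show ?thesis using zero by (simp add: inc_alg_def)
  qed
  have "?e' \<star> h + h \<star> ?e' = ?a + ?b"
    using False by (simp add: fun_eq_iff unit_mult mult_unit yy h)
      (auto simp: h_app inc_scale_apply inc_unit_def)
  then have "\<tau> h x y = \<tau> (?a + ?b) x y" using jordan_diag[OF yy h, of x y] False by simp
  also have "\<dots> = f x y * \<tau> (inc_unit x y) x y"
    using a b by (simp add: add scale inc_unit_in_alg xy) (simp add: inc_scale_apply)
  finally show ?thesis
    using jordan_diag[OF xx f, of x y] False by (simp add: h_def)
qed

lemma unit_additive:
  assumes xz: "(x, z) \<in> le" and zy: "(z, y) \<in> le"
  shows "\<tau> (inc_unit x y) x y = \<tau> (inc_unit x z) x z + \<tau> (inc_unit z y) z y"
proof (cases "x = z \<or> z = y")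
  case True
  then show ?thesis using assms by (auto simp: vanish)
next
  case False
  let ?a = "inc_unit x z :: 'x \<Rightarrow> 'x \<Rightarrow> 'r" and ?b = "inc_unit z y :: 'x \<Rightarrow> 'x \<Rightarrow> 'r"
  have xy: "(x, y) \<in> le" using xz zy by (rule le_trans)
  have a: "?a \<in> inc_alg le" and b: "?b \<in> inc_alg le"
    using assms by (simp_all add: inc_unit_in_alg)
  \<comment> \<open>A pre-order allows \<open>x = y\<close> here; then \<open>?b \<star> ?a\<close>
    is the diagonal unit at \<open>z\<close>, which still vanishes at \<open>(x, y)\<close>.\<close>
  have "(?a \<star> ?b + ?b \<star> ?a) x y = 1"
    using False by (simp add: unit_mult xz zy a b) (simp add: inc_unit_def)
  then have "\<tau> (?a \<star> ?b + ?b \<star> ?a) x y = \<tau> (inc_unit x y) x y"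
    using pointwise[OF _ xy, of "?a \<star> ?b + ?b \<star> ?a"] by (simp add: inc_alg_add mult_in_alg)
  then show ?thesis
    using False not_sym[of z y] by (simp add: jordan a b unit_mult mult_unit xz zy closed)
qed

text \<open>Additivity of the multiplier along x \<le> z \<le> y gives the product rule for each
  summand of the convolution.\<close>

lemma leibniz:
  assumes f: "f \<in> inc_alg le" and g: "g \<in> inc_alg le"
  shows "\<tau> (f \<star> g) = \<tau> f \<star> g + f \<star> \<tau> g"
proof (intro ext)
  fix x y
  show "\<tau> (f \<star> g) x y = (\<tau> f \<star> g + f \<star> \<tau> g) x y"
  proof (cases "(x, y) \<in> le")
    case True
    then have "\<tau> (f \<star> g) x y =
        (\<Sum>z | (x, z) \<in> le \<and> (z, y) \<in> le. f x z * g z y * \<tau> (inc_unit x y) x y)"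
      by (simp only: pointwise[OF mult_in_alg True]) (simp add: inc_mult_def sum_distrib_right)
    also have "\<dots> = (\<Sum>z | (x, z) \<in> le \<and> (z, y) \<in> le. \<tau> f x z * g z y + f x z * \<tau> g z y)"
      by (intro sum.cong)
         (auto simp: pointwise[OF f] pointwise[OF g] unit_additive[of x _ y] algebra_simps)
    also have "\<dots> = (\<tau> f \<star> g + f \<star> \<tau> g) x y" by (simp add: inc_mult_def sum.distrib)
    finally show ?thesis .
  next
    case False
    moreover have "\<tau> (f \<star> g) \<in> inc_alg le" "\<tau> f \<star> g + f \<star> \<tau> g \<in> inc_alg le"
      by (simp_all add: closed mult_in_alg inc_alg_add)
    ultimately show ?thesis unfolding inc_alg_def mem_Collect_eq by metis
  qed
qed

end

section \<open>Reduction to the diagonal case by an inner derivation\<close>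

context finitary_jordan
begin

theorem jordan_leibniz:
  assumes tf: "two_torsion_free TYPE('r)" and f: "f \<in> inc_alg le" and g: "g \<in> inc_alg le"
  shows "\<tau> (f \<star> g) = \<tau> f \<star> g + f \<star> \<tau> g"
proof -
  \<comment> \<open>Row \<open>x\<close> of \<open>w\<close> is row \<open>x\<close> of the image of
    the unit at \<open>x\<close>. The value 0 off \<open>le\<close> covers points outside the
    carrier, where \<open>\<tau>\<close> is unconstrained.\<close>
  define w where "w x y = (if (x, y) \<in> le then \<tau> (inc_unit x x) x y else 0)" for x y
  define \<sigma> where "\<sigma> f = \<tau> f - (f \<star> w - w \<star> f)" for f
  have w: "w \<in> inc_alg le" by (simp add: inc_alg_def w_def)
  have \<sigma>_unit: "\<sigma> (inc_unit x x) = 0" if xx: "(x, x) \<in> le" for x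
  proof (intro ext)
    fix u v
    let ?e = "inc_unit x x :: 'x \<Rightarrow> 'x \<Rightarrow> 'r"
    have e: "?e \<in> inc_alg le" using xx by (rule inc_unit_in_alg)
    have t: "\<tau> ?e x x = 0" using unit_diag[OF xx, of x x] by simp
    have off: "\<tau> ?e u' v' = 0" if "(u', v') \<notin> le" for u' v'
      using closed[OF e] that by (simp add: inc_alg_def)
    \<comment> \<open>The commutator of the unit with \<open>w\<close> has row \<open>x\<close> of
      \<open>w\<close> as its row and minus column \<open>x\<close> of \<open>w\<close> as its
      column, so these two facts match it to \<open>unit_diag\<close>.\<close>
    have row: "w x v = \<tau> ?e x v" by (simp add: w_def off)
    have col: "w u x = - \<tau> ?e u x"
      using unit_diag_orthogonal[of u x] t by (cases "u = x") (auto simp: w_def off)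
    show "\<sigma> ?e u v = 0 u v"
      using unit_diag[OF xx, of u v]
      by (simp add: \<sigma>_def unit_mult mult_unit xx w row col)
  qed
  interpret \<sigma>: diagonal_jordan X le \<sigma>
  proof
    fix f g :: "'x \<Rightarrow> 'x \<Rightarrow> 'r" and c :: 'r
    assume f: "f \<in> inc_alg le"
    show "\<sigma> f \<in> inc_alg le"
      by (simp add: \<sigma>_def inc_alg_diff mult_in_alg closed f)
    show "\<sigma> (inc_scale c f) = inc_scale c (\<sigma> f)"
      by (simp add: \<sigma>_def scale f inc_mult_scale_left inc_mult_scale_right)
         (simp add: inc_scale_apply fun_eq_iff right_diff_distrib)
    show "\<sigma> (f + g) = \<sigma> f + \<sigma> g" if "g \<in> inc_alg le"
      by (simp add: \<sigma>_def add f that inc_mult_add_left inc_mult_add_right)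
    show "\<sigma> (f \<star> f) = \<sigma> f \<star> f + f \<star> \<sigma> f"
      by (simp add: \<sigma>_def square f inc_mult_diff_left inc_mult_diff_right mult_assoc)
  qed (use \<sigma>_unit tf in auto)
  \<comment> \<open>The commutator with \<open>w\<close> obeys the product rule by associativity, so
    the rule passes from \<open>\<sigma>\<close> back to \<open>\<tau>\<close>.\<close>
  have "\<tau> h = \<sigma> h + (h \<star> w - w \<star> h)" for h by (simp add: \<sigma>_def)
  then show ?thesis
    using \<sigma>.leibniz[OF f g]
    by (simp add: inc_mult_add_left inc_mult_add_right inc_mult_diff_left inc_mult_diff_right
        mult_assoc)
qed

end

section \<open>From the generalized Jordan identity to the generalized product rule\<close>

theorem theorem2p1:
  fixes X :: "'x set" and le :: "'x rel"
    and d :: "('x \<Rightarrow> 'x \<Rightarrow> 'r::{comm_ring, monoid_mult}) \<Rightarrow> 'x \<Rightarrow> 'x \<Rightarrow> 'r"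
  assumes "two_torsion_free TYPE('r)"
    and "preorder_on X le"
    and "locally_finite_rel le"
    and "generalized_jordan_derivation le d"
  shows "generalized_derivation le d"
proof -
  interpret lf_preorder X le using assms by unfold_locales
  obtain \<tau> where d: "inc_linear le d" and \<tau>: "jordan_derivation le \<tau>"
    and sq: "\<And>a. a \<in> inc_alg le \<Longrightarrow> d (a \<star> a) = d a \<star> a + a \<star> \<tau> a"
    using assms(4) by (auto simp: generalized_jordan_derivation_def inc_add_eq_plus)
  have d_add: "d (f + g) = d f + d g" if "f \<in> inc_alg le" "g \<in> inc_alg le" for f g
    using d that unfolding inc_linear_def inc_add_eq_plus by blast
  have d_closed: "d f \<in> inc_alg le" if "f \<in> inc_alg le" for f
    using d that unfolding inc_linear_def by blast
  interpret finitary_jordan X le \<tau>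
    using \<tau> by unfold_locales
      (simp_all add: jordan_derivation_def inc_linear_def inc_add_eq_plus)
  have \<tau>_leibniz: "\<tau> (f \<star> g) = \<tau> f \<star> g + f \<star> \<tau> g" if "f \<in> inc_alg le" "g \<in> inc_alg le" for f g
    using jordan_leibniz assms(1) that by blast
  let ?one = "inc_one le :: 'x \<Rightarrow> 'x \<Rightarrow> 'r"
  note one = inc_one_in_alg[of le, where 'b = 'r]
  have \<tau>_one: "\<tau> ?one = 0"
    using \<tau>_leibniz[OF one one] by (simp add: one_mult mult_one one closed)
  have d_eq: "d a = d ?one \<star> a + \<tau> a" if a: "a \<in> inc_alg le" for a
  proof -
    \<comment> \<open>The square yields \<open>d a\<close> twice and the generalized identity yields
      it once, so cancellation leaves exactly one copy.\<close>
    have "(a + ?one) \<star> (a + ?one) = a \<star> a + (a + (a + ?one))"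
      by (simp add: inc_mult_add_left inc_mult_add_right one_mult mult_one a one)
    then have "d ((a + ?one) \<star> (a + ?one)) = d (a \<star> a) + (d a + (d a + d ?one))"
      by (simp add: d_add inc_alg_add mult_in_alg a one)
    moreover have "d ((a + ?one) \<star> (a + ?one)) = (d a + d ?one) \<star> (a + ?one) + (a + ?one) \<star> \<tau> a"
      by (simp add: sq d_add add inc_alg_add a one \<tau>_one)
    ultimately show ?thesis
      by (simp add: sq a one inc_mult_add_left inc_mult_add_right one_mult mult_one closed d_closed
          algebra_simps)
  qed
  \<comment> \<open>Expand \<open>d (a \<star> b)\<close> by \<open>d_eq\<close> and the product
    rule for \<open>\<tau>\<close>; the terms ending in \<open>b\<close> regroup to
    \<open>d a \<star> b\<close>.\<close>
  have "d (a \<star> b) = d a \<star> b + a \<star> \<tau> b" if "a \<in> inc_alg le" "b \<in> inc_alg le" for a b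
    using d_eq[OF mult_in_alg, of a b] d_eq[OF that(1)] \<tau>_leibniz[OF that]
    by (simp add: inc_mult_add_left mult_assoc add.assoc)
  moreover have "derivation le \<tau>"
    using \<tau> \<tau>_leibniz by (simp add: derivation_def jordan_derivation_def inc_add_eq_plus)
  ultimately show ?thesis
    using d by (auto simp: generalized_derivation_def inc_add_eq_plus)
qed

end
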